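(* Let $G$ be a quasi-split connected reductive group over a $p$-adic field $F$ and let $\lambda:W_F\to{}^LG$ be an infinitesimal parameter. Under the orbit duality $C\mapsto C^*$ between $H_\lambda$-orbits in $V_\lambda$ and in $V_\lambda^*$, the dual of the closed orbit $C_0$ in $V_\lambda$ is the open orbit in $V_\lambda^*$, and the dual of the open orbit $C^o$ in $V_\lambda$ is the closed orbit in $V_\lambda^*$.
   Context: $W_F$ is the Weil group of $F$ with norm $|\cdot|$; $\widehat G$ is the dual group with Lie algebra $\widehat{\mathfrak g}$, ${}^LG=\widehat G\rtimes W_F$. An infinitesimal parameter is a continuous homomorphism $\lambda:W_F\to{}^LG$ whose composition with ${}^LG\to W_F$ is the identity (as for Langlands parameters, $\lambda$ of a Frobenius element is semisimple). Put $V_\lambda=\{x\in\widehat{\mathfrak g}:\mathrm{Ad}(\lambda(w))x=|w|x\ \forall w\in W_F\}$, $V_\lambda^*=\{y\in\widehat{\mathfrak g}:\mathrm{Ad}(\lambda(w))y=|w|^{-1}y\ \forall w\in W_F\}$ (identified with the dual of $V_\lambda$ via the Killing form), and $H_\lambda=Z_{\widehat G}(\lambda)$, which acts on both by conjugation with finitely many orbits, each space having a unique open orbit and a unique closed orbit. For an $H_\lambda$-orbit $C\subset V_\lambda$ let $\Lambda_C=\{(x,y)\in C\times V_\lambda^*:[x,y]=0\}$; for an orbit $D\subset V_\lambda^*$ let $\Lambda_D^*=\{(y,x)\in D\times V_\lambda:[x,y]=0\}$. Orbit (Pyasetskii) duality $C\mapsto C^*$ is the bijection from $H_\lambda$-orbits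 in $V_\lambda$ to $H_\lambda$-orbits in $V_\lambda^*$ uniquely characterized by: under $(x,y)\mapsto(y,x)$ the closure of $\Lambda_C$ corresponds to the closure of $\Lambda^*_{C^*}$. *)

theory Defs
  imports
    "HOL-Analysis.Analysis"
    "HOL-Algebra.Algebraic_Closure_Type"
    "HOL-Algebra.Solvable_Groups"
    "HOL-Algebra.Group_Action"
begin

section \<open>Polynomial functions and the Zariski topology\<close>

text \<open>Polynomial expressions in the coordinate functions \<open>E\<close> with coefficients generated by \<open>K\<close>.\<close>

inductive_set poly_fun :: "'k::comm_ring_1 set \<Rightarrow> ('a \<Rightarrow> 'k) set \<Rightarrow> ('a \<Rightarrow> 'k) set"
  for K :: "'k set" and E :: "('a \<Rightarrow> 'k) set" where
  const: "c \<in> K \<Longrightarrow> (\<lambda>_. c) \<in> poly_fun K E"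
| gen: "e \<in> E \<Longrightarrow> e \<in> poly_fun K E"
| add: "f \<in> poly_fun K E \<Longrightarrow> g \<in> poly_fun K E \<Longrightarrow> (\<lambda>x. f x + g x) \<in> poly_fun K E"
| mult: "f \<in> poly_fun K E \<Longrightarrow> g \<in> poly_fun K E \<Longrightarrow> (\<lambda>x. f x * g x) \<in> poly_fun K E"

definition zariski :: "('a \<Rightarrow> 'k::idom) set \<Rightarrow> 'a topology" where
  "zariski E = topology (\<lambda>U. \<exists>P \<subseteq> poly_fun UNIV E. U = {x. \<exists>p\<in>P. p x \<noteq> 0})"

lemma openin_zariski:
  "openin (zariski E) U \<longleftrightarrow> (\<exists>P \<subseteq> poly_fun UNIV E. U = {x. \<exists>p\<in>P. p x \<noteq> 0})"
proof -
  define L where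
    "L = (\<lambda>U. \<exists>P \<subseteq> poly_fun (UNIV :: 'b set) E. U = {x. \<exists>p\<in>P. p x \<noteq> 0})"
  have "L (S \<inter> T)" if "L S" "L T" for S T
  proof -
    from \<open>L S\<close> obtain P where P: "P \<subseteq> poly_fun UNIV E" "S = {x. \<exists>p\<in>P. p x \<noteq> 0}"
      unfolding L_def by (elim exE conjE)
    from \<open>L T\<close> obtain Q where Q: "Q \<subseteq> poly_fun UNIV E" "T = {x. \<exists>p\<in>Q. p x \<noteq> 0}"
      unfolding L_def by (elim exE conjE)
    let ?R = "{r. \<exists>p\<in>P. \<exists>q\<in>Q. r = (\<lambda>x. p x * q x)}"
    have "?R \<subseteq> poly_fun UNIV E"
    proof
      fix r assume "r \<in> ?R"
      then obtain p q where "p \<in> P" "q \<in> Q" "r = (\<lambda>x. p x * q x)" by blast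
      then show "r \<in> poly_fun UNIV E" using P(1) Q(1) poly_fun.mult[of p UNIV E q] by auto
    qed
    moreover have eq: "(x \<in> S \<inter> T) = (\<exists>r\<in>?R. r x \<noteq> 0)" for x
    proof
      assume "x \<in> S \<inter> T"
      then obtain p q where pq: "p \<in> P" "p x \<noteq> 0" "q \<in> Q" "q x \<noteq> 0" using P(2) Q(2) by auto
      then have "(\<lambda>x. p x * q x) \<in> ?R" by blast
      with pq show "\<exists>r\<in>?R. r x \<noteq> 0" by (intro bexI[of _ "\<lambda>x. p x * q x"]) simp_all
    next
      assume "\<exists>r\<in>?R. r x \<noteq> 0"
      then obtain p q where "p \<in> P" "q \<in> Q" "p x * q x \<noteq> 0" by auto
      then have "p \<in> P" "p x \<noteq> 0" "q \<in> Q" "q x \<noteq> 0" by simp_all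
      then show "x \<in> S \<inter> T" using P(2) Q(2) by auto
    qed
    have "S \<inter> T = {x. \<exists>r\<in>?R. r x \<noteq> 0}"
      by (rule Set.set_eqI) (simp only: eq mem_Collect_eq[of _ "\<lambda>x. \<exists>r\<in>?R. r x \<noteq> 0"])
    ultimately show ?thesis unfolding L_def by (intro exI[of _ ?R] conjI)
  qed
  moreover have "L (\<Union>\<K>)" if K: "\<forall>S\<in>\<K>. L S" for \<K>
  proof -
    let ?R = "{p \<in> poly_fun UNIV E. \<exists>S\<in>\<K>. {x. p x \<noteq> 0} \<subseteq> S}"
    have eq: "(x \<in> \<Union>\<K>) = (\<exists>p\<in>?R. p x \<noteq> 0)" for x
    proof
      assume "x \<in> \<Union>\<K>"
      then obtain S where S: "S \<in> \<K>" "x \<in> S" by (elim UnionE)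
      with K have "L S" by simp
      then obtain P where P: "P \<subseteq> poly_fun UNIV E" "S = {x. \<exists>p\<in>P. p x \<noteq> 0}"
        unfolding L_def by (elim exE conjE)
      with S(2) obtain p where p: "p \<in> P" "p x \<noteq> 0" by auto
      then have "{x. p x \<noteq> 0} \<subseteq> S" using P(2) by auto
      then have "p \<in> ?R" using p(1) P(1) S(1) by auto
      with p(2) show "\<exists>p\<in>?R. p x \<noteq> 0" by (rule bexI)
    next
      assume "\<exists>p\<in>?R. p x \<noteq> 0"
      then obtain p where p: "p \<in> ?R" "p x \<noteq> 0" by (elim bexE)
      from p(1) have "\<exists>S\<in>\<K>. {x. p x \<noteq> 0} \<subseteq> S" by simp
      then obtain S where "S \<in> \<K>" "{x. p x \<noteq> 0} \<subseteq> S" by (elim bexE)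
      with p(2) show "x \<in> \<Union>\<K>" by auto
    qed
    have "\<Union>\<K> = {x. \<exists>p\<in>?R. p x \<noteq> 0}"
      by (rule Set.set_eqI) (simp only: eq mem_Collect_eq[of _ "\<lambda>x. \<exists>r\<in>?R. r x \<noteq> 0"])
    moreover have "?R \<subseteq> poly_fun UNIV E" by simp
    ultimately show ?thesis unfolding L_def by (intro exI[of _ ?R] conjI)
  qed
  ultimately have "istopology L" unfolding istopology_def by simp
  then have "openin (topology L) U = L U" by (simp add: topology_inverse')
  then show ?thesis unfolding zariski_def L_def .
qed

definition entries :: "('k^'n^'n \<Rightarrow> 'k) set" where
  "entries = {(\<lambda>A. A $ i $ j) | i j. True}"

definition entries2 :: "(('k^'n^'n) \<times> ('k^'n^'n) \<Rightarrow> 'k) set" where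
  "entries2 = {e \<circ> fst | e. e \<in> entries} \<union> {e \<circ> snd | e. e \<in> entries}"

definition regular_fun :: "('k::field^'n^'n \<Rightarrow> 'k) set" where
  "regular_fun = poly_fun UNIV (insert (\<lambda>A. inverse (det A)) entries)"


section \<open>Linear algebraic groups\<close>

text \<open>A linear algebraic group is identified with its points over an algebraically closed field,
  as a Zariski closed subgroup of \<open>GL\<^sub>n\<close>; it is defined over a subfield \<open>K\<close> if
  it is cut out by polynomials with coefficients in \<open>K\<close>.  (The fields below have
  characteristic \<open>0\<close>, so no scheme structure is lost.)\<close>

definition matgrp :: "('k::semiring_1^'n^'n) set \<Rightarrow> ('k^'n^'n) monoid" where
  "matgrp G = \<lparr>carrier = G, monoid.mult = (**), one = mat 1\<rparr>"

definition alg_group :: "'k::field set \<Rightarrow> ('k^'n^'n) set \<Rightarrow> bool" where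
  "alg_group K G \<longleftrightarrow> subgroup G (matgrp {A. invertible A}) \<and>
     (\<exists>P \<subseteq> poly_fun K entries. G = {g. invertible g \<and> (\<forall>p\<in>P. p g = 0)})"

definition zariski_connected :: "('k::field^'n^'n) set \<Rightarrow> bool" where
  "zariski_connected G \<longleftrightarrow> connected_space (subtopology (zariski entries) G)"

definition alg_hom :: "('k::field^'n^'n) set \<Rightarrow> ('k^'m^'m) set \<Rightarrow> ('k^'n^'n \<Rightarrow> 'k^'m^'m) \<Rightarrow> bool" where
  "alg_hom G H \<phi> \<longleftrightarrow> \<phi> \<in> hom (matgrp G) (matgrp H) \<and>
     (\<forall>i j. \<exists>f\<in>regular_fun. \<forall>g\<in>G. \<phi> g $ i $ j = f g)"

definition unipotent :: "'k::field^'n^'n \<Rightarrow> bool" where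
  "unipotent u \<longleftrightarrow> (\<exists>k. (((**) (u - mat 1)) ^^ k) (mat 1) = 0)"

text \<open>Reductive: trivial unipotent radical.\<close>

definition connected_reductive :: "'k::field set \<Rightarrow> ('k^'n^'n) set \<Rightarrow> bool" where
  "connected_reductive K G \<longleftrightarrow> alg_group K G \<and> zariski_connected G \<and>
     (\<forall>U. alg_group UNIV U \<and> zariski_connected U \<and> U \<lhd> matgrp G \<and> (\<forall>u\<in>U. unipotent u)
        \<longrightarrow> U = {mat 1})"

definition borel_subgroup :: "('k::field^'n^'n) set \<Rightarrow> ('k^'n^'n) set \<Rightarrow> bool" where
  "borel_subgroup G B \<longleftrightarrow>
     (let solv = (\<lambda>S. alg_group UNIV S \<and> zariski_connected S \<and> solvable (matgrp S) \<and> S \<subseteq> G)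
      in solv B \<and> (\<forall>S. solv S \<and> B \<subseteq> S \<longrightarrow> S = B))"

definition torus :: "('k::field^'n^'n) set \<Rightarrow> bool" where
  "torus T \<longleftrightarrow> alg_group UNIV T \<and> zariski_connected T \<and>
     (\<exists>P :: 'k^'n^'n. invertible P \<and> (\<forall>t\<in>T. \<forall>i j. i \<noteq> j \<longrightarrow> (P ** t ** matrix_inv P) $ i $ j = 0))"

definition maximal_torus :: "('k::field^'n^'n) set \<Rightarrow> ('k^'n^'n) set \<Rightarrow> bool" where
  "maximal_torus G T \<longleftrightarrow> torus T \<and> T \<subseteq> G \<and> (\<forall>S. torus S \<and> S \<subseteq> G \<and> T \<subseteq> S \<longrightarrow> S = T)"

definition quasi_split :: "'k::field set \<Rightarrow> ('k^'n^'n) set \<Rightarrow> bool" where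
  "quasi_split K G \<longleftrightarrow> (\<exists>B. borel_subgroup G B \<and> alg_group K B)"


section \<open>Lie algebras\<close>

text \<open>The tangent space at the identity: \<open>Y\<close> such that \<open>p(1 + tY)\<close> has no linear term in \<open>t\<close>
  for every polynomial \<open>p\<close> vanishing on \<open>G\<close>.  Here \<open>mat t ** Y\<close> is the scalar multiple \<open>tY\<close>.\<close>

definition lie_alg :: "('k::field^'n^'n) set \<Rightarrow> ('k^'n^'n) set" where
  "lie_alg G = {Y. \<forall>p \<in> poly_fun UNIV entries. (\<forall>g\<in>G. p g = 0) \<longrightarrow>
     (\<exists>f. (\<forall>t. p (mat 1 + mat t ** Y) = Polynomial.poly f t) \<and> Polynomial.coeff f 1 = 0)}"

text \<open>The differential at the identity of a homomorphism of complex algebraic groups: each entry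
  of \<open>\<phi>\<close> is extended to a regular function near the identity and differentiated in the direction
  \<open>Y \<in> lie_alg G\<close>; the result does not depend on the extensions.\<close>

definition differential ::
  "(complex^'n^'n) set \<Rightarrow> (complex^'n^'n \<Rightarrow> complex^'n^'n) \<Rightarrow> complex^'n^'n \<Rightarrow> complex^'n^'n" where
  "differential G \<phi> Y = (THE Z. \<forall>i j. \<exists>f\<in>regular_fun. (\<forall>g\<in>G. \<phi> g $ i $ j = f g) \<and>
     ((\<lambda>t. f (mat 1 + mat t ** Y)) has_field_derivative Z $ i $ j) (at 0))"


section \<open>Root data\<close>

text \<open>Characters and cocharacters are extensional functions, so that the character and
  cocharacter lattices are honest groups (written multiplicatively).\<close>

definition character_group :: "('k::field^'n^'n) set \<Rightarrow> ('k^'n^'n \<Rightarrow> 'k) monoid" where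
  "character_group T = \<lparr>
     carrier = {\<xi> \<in> extensional T. (\<forall>t\<in>T. \<xi> t \<noteq> 0) \<and> (\<forall>s\<in>T. \<forall>t\<in>T. \<xi> (s ** t) = \<xi> s * \<xi> t) \<and>
                  (\<exists>f\<in>regular_fun. \<forall>t\<in>T. \<xi> t = f t)},
     monoid.mult = (\<lambda>\<xi> \<psi>. \<lambda>t\<in>T. \<xi> t * \<psi> t), one = (\<lambda>t\<in>T. 1)\<rparr>"

definition cocharacter_group :: "('k::field^'n^'n) set \<Rightarrow> ('k \<Rightarrow> 'k^'n^'n) monoid" where
  "cocharacter_group T = \<lparr>
     carrier = {\<mu> \<in> extensional (- {0}). (\<forall>z. z \<noteq> 0 \<longrightarrow> \<mu> z \<in> T) \<and>
                  (\<forall>y z. y \<noteq> 0 \<and> z \<noteq> 0 \<longrightarrow> \<mu> (y * z) = \<mu> y ** \<mu> z) \<and>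
                  (\<forall>i j. \<exists>f \<in> poly_fun UNIV {\<lambda>z. z, inverse}. \<forall>z. z \<noteq> 0 \<longrightarrow> \<mu> z $ i $ j = f z)},
     monoid.mult = (\<lambda>\<mu> \<nu>. \<lambda>z\<in>- {0}. \<mu> z ** \<nu> z), one = (\<lambda>z\<in>- {0}. mat 1)\<rparr>"

text \<open>\<open>pairing \<xi> \<mu> n\<close> says that \<open>\<langle>\<xi>, \<mu>\<rangle> = n\<close>.\<close>

definition pairing :: "('k::field^'n^'n \<Rightarrow> 'k) \<Rightarrow> ('k \<Rightarrow> 'k^'n^'n) \<Rightarrow> int \<Rightarrow> bool" where
  "pairing \<xi> \<mu> n \<longleftrightarrow> (\<forall>z. z \<noteq> 0 \<longrightarrow> \<xi> (\<mu> z) = z powi n)"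

definition weight_space ::
  "('k::field^'n^'n) set \<Rightarrow> ('k^'n^'n) set \<Rightarrow> ('k^'n^'n \<Rightarrow> 'k) \<Rightarrow> ('k^'n^'n) set" where
  "weight_space G T \<alpha> = {Y \<in> lie_alg G. \<forall>t\<in>T. t ** Y ** matrix_inv t = mat (\<alpha> t) ** Y}"

text \<open>\<open>roots B T\<close> for a Borel subgroup \<open>B\<close> containing \<open>T\<close> is the set of positive roots.\<close>

definition roots :: "('k::field^'n^'n) set \<Rightarrow> ('k^'n^'n) set \<Rightarrow> ('k^'n^'n \<Rightarrow> 'k) set" where
  "roots G T = {\<alpha> \<in> carrier (character_group T). \<alpha> \<noteq> one (character_group T) \<and>
     (\<exists>Y \<in> weight_space G T \<alpha>. Y \<noteq> 0)}"

definition simple_roots :: "('k::field^'n^'n) set \<Rightarrow> ('k^'n^'n) set \<Rightarrow> ('k^'n^'n \<Rightarrow> 'k) set" where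
  "simple_roots B T =
     {\<alpha> \<in> roots B T. \<not> (\<exists>\<beta>\<in>roots B T. \<exists>\<gamma>\<in>roots B T. \<alpha> = \<beta> \<otimes>\<^bsub>character_group T\<^esub> \<gamma>)}"

definition mat2 :: "'k \<Rightarrow> 'k \<Rightarrow> 'k \<Rightarrow> 'k \<Rightarrow> 'k::zero^2^2" where
  "mat2 a b c d = vector [vector [a, b], vector [c, d]]"

text \<open>\<open>\<mu>\<close> is the coroot of the root \<open>\<alpha>\<close>: it is the restriction to the diagonal torus of the
  homomorphism from \<open>SL\<^sub>2\<close> to \<open>G\<close> attached to \<open>\<alpha>\<close>.\<close>

definition is_coroot ::
  "('k::field^'n^'n) set \<Rightarrow> ('k^'n^'n) set \<Rightarrow> ('k^'n^'n \<Rightarrow> 'k) \<Rightarrow> ('k \<Rightarrow> 'k^'n^'n) \<Rightarrow> bool" where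
  "is_coroot G T \<alpha> \<mu> \<longleftrightarrow> \<alpha> \<in> roots G T \<and> \<mu> \<in> carrier (cocharacter_group T) \<and>
     (\<exists>\<phi>. alg_hom {A :: 'k^2^2. det A = 1} G \<phi> \<and>
        (\<forall>z. z \<noteq> 0 \<longrightarrow> \<phi> (mat2 z 0 0 (inverse z)) = \<mu> z) \<and>
        (\<exists>a. \<phi> (mat2 1 a 0 1) \<noteq> mat 1) \<and>
        (\<forall>t\<in>T. \<forall>a. t ** \<phi> (mat2 1 a 0 1) ** matrix_inv t = \<phi> (mat2 1 (\<alpha> t * a) 0 1) \<and>
                    t ** \<phi> (mat2 1 0 a 1) ** matrix_inv t = \<phi> (mat2 1 0 (inverse (\<alpha> t) * a) 1)))"


section \<open>$p$-adic fields and their Weil groups\<close>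

text \<open>A \<open>p\<close>-adic field is a finite extension of \<open>\<rat>\<^sub>p\<close>.  It is presented as a field of
  characteristic \<open>0\<close> complete for a nonarchimedean absolute value \<open>ab\<close> which restricts to the
  \<open>p\<close>-adic one on \<open>\<rat>\<close>, and finite over the closure of \<open>\<rat>\<close>, which is then \<open>\<rat>\<^sub>p\<close>.\<close>

definition rat_closure :: "('f::field_char_0 \<Rightarrow> real) \<Rightarrow> 'f set" where
  "rat_closure ab = {x. \<forall>e>0. \<exists>r. ab (x - of_rat r) < e}"

definition p_adic_field :: "('f::field_char_0 \<Rightarrow> real) \<Rightarrow> bool" where
  "p_adic_field ab \<longleftrightarrow> (\<exists>p::nat. Factorial_Ring.prime p \<and>
     (\<forall>x. 0 \<le> ab x) \<and> (\<forall>x. ab x = 0 \<longleftrightarrow> x = 0) \<and>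
     (\<forall>x y. ab (x * y) = ab x * ab y) \<and> (\<forall>x y. ab (x + y) \<le> max (ab x) (ab y)) \<and>
     ab (of_nat p) = 1 / real p \<and>
     (\<forall>s :: nat \<Rightarrow> 'f. (\<forall>e>0. \<exists>M. \<forall>m\<ge>M. \<forall>n\<ge>M. ab (s m - s n) < e) \<longrightarrow>
        (\<exists>l. \<forall>e>0. \<exists>M. \<forall>n\<ge>M. ab (s n - l) < e)) \<and>
     (\<exists>B. finite B \<and> (\<forall>x. \<exists>c. (\<forall>b\<in>B. c b \<in> rat_closure ab) \<and> x = (\<Sum>b\<in>B. c b * b))))"

definition residue_card :: "('f::field_char_0 \<Rightarrow> real) \<Rightarrow> nat" where
  "residue_card ab = card ({x. ab x \<le> 1} // {(x, y). ab x \<le> 1 \<and> ab y \<le> 1 \<and> ab (x - y) < 1})"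

text \<open>The integral closure of the ring of integers in the algebraic closure, and its maximal ideal.\<close>

definition integers_ac :: "('f::field_char_0 \<Rightarrow> real) \<Rightarrow> 'f alg_closure set" where
  "integers_ac ab = {x. \<exists>f :: 'f poly. Polynomial.lead_coeff f = 1 \<and> (\<forall>i. ab (Polynomial.coeff f i) \<le> 1) \<and>
     Polynomial.poly (map_poly to_ac f) x = 0}"

definition max_ideal_ac :: "('f::field_char_0 \<Rightarrow> real) \<Rightarrow> 'f alg_closure set" where
  "max_ideal_ac ab = {x \<in> integers_ac ab. x = 0 \<or> inverse x \<notin> integers_ac ab}"

definition galois :: "('f::field alg_closure \<Rightarrow> 'f alg_closure) set" where
  "galois = {\<sigma>. bij \<sigma> \<and> (\<forall>x y. \<sigma> (x + y) = \<sigma> x + \<sigma> y) \<and> (\<forall>x y. \<sigma> (x * y) = \<sigma> x * \<sigma> y) \<and>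
     (\<forall>c. \<sigma> (to_ac c) = to_ac c)}"

text \<open>\<open>frob_degree ab \<sigma> n\<close>: \<open>\<sigma>\<close> acts on the residue field of the algebraic closure as the \<open>n\<close>-th power of
  the arithmetic Frobenius \<open>x \<mapsto> x\<^sup>q\<close>.\<close>

definition frob_degree ::
  "('f::field_char_0 \<Rightarrow> real) \<Rightarrow> ('f alg_closure \<Rightarrow> 'f alg_closure) \<Rightarrow> int \<Rightarrow> bool" where
  "frob_degree ab \<sigma> n \<longleftrightarrow> (\<forall>x \<in> integers_ac ab.
     if n \<ge> 0 then \<sigma> x - x ^ (residue_card ab ^ nat n) \<in> max_ideal_ac ab
     else \<sigma> x ^ (residue_card ab ^ nat (- n)) - x \<in> max_ideal_ac ab)"

definition weil_group ::
  "('f::field_char_0 \<Rightarrow> real) \<Rightarrow> ('f alg_closure \<Rightarrow> 'f alg_closure) monoid" where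
  "weil_group ab = \<lparr>carrier = {\<sigma> \<in> galois. \<exists>n. frob_degree ab \<sigma> n},
     monoid.mult = (\<circ>), one = id\<rparr>"

text \<open>The norm, normalised so that \<open>w\<close> acts on the residue field as \<open>x \<mapsto> x\<^bsup>|w|\<^esup>\<close>.\<close>

definition weil_norm ::
  "('f::field_char_0 \<Rightarrow> real) \<Rightarrow> ('f alg_closure \<Rightarrow> 'f alg_closure) \<Rightarrow> real" where
  "weil_norm ab w = real (residue_card ab) powi (THE n. frob_degree ab w n)"

text \<open>The topology for which inertia, with its profinite (Krull) topology, is an open subgroup.
  Elements of the same norm lie in the same coset of inertia.\<close>

definition weil_topology ::
  "('f::field_char_0 \<Rightarrow> real) \<Rightarrow> ('f alg_closure \<Rightarrow> 'f alg_closure) topology" where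
  "weil_topology ab = topology (\<lambda>U. U \<subseteq> carrier (weil_group ab) \<and> (\<forall>w\<in>U. \<exists>S. finite S \<and>
     {v \<in> carrier (weil_group ab). weil_norm ab v = weil_norm ab w \<and> (\<forall>x\<in>S. v x = w x)} \<subseteq> U))"

lemma openin_weil_topology:
  "openin (weil_topology ab) U \<longleftrightarrow> U \<subseteq> carrier (weil_group ab) \<and> (\<forall>w\<in>U. \<exists>S. finite S \<and>
     {v \<in> carrier (weil_group ab). weil_norm ab v = weil_norm ab w \<and> (\<forall>x\<in>S. v x = w x)} \<subseteq> U)"
proof -
  define N where "N = (\<lambda>w S. {v \<in> carrier (weil_group ab).
     weil_norm ab v = weil_norm ab w \<and> (\<forall>x\<in>S. v x = w x)})"
  define L where
    "L = (\<lambda>U. U \<subseteq> carrier (weil_group ab) \<and> (\<forall>w\<in>U. \<exists>S. finite S \<and> N w S \<subseteq> U))"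
  have N_mono: "N w (S \<union> T) \<subseteq> N w S \<inter> N w T" for w S T
    by (auto simp: N_def)
  have "L (A \<inter> B)" if "L A" "L B" for A B
    unfolding L_def
  proof (intro conjI ballI)
    show "A \<inter> B \<subseteq> carrier (weil_group ab)" using \<open>L A\<close> by (auto simp: L_def)
    fix w assume "w \<in> A \<inter> B"
    with \<open>L A\<close> \<open>L B\<close> obtain S T where "finite S" "N w S \<subseteq> A" "finite T" "N w T \<subseteq> B"
      unfolding L_def by (metis IntD1 IntD2)
    then show "\<exists>S. finite S \<and> N w S \<subseteq> A \<inter> B"
      using N_mono[of w S T] by (intro exI[of _ "S \<union> T"]) auto
  qed
  moreover have "L (\<Union>\<K>)" if K: "\<forall>A\<in>\<K>. L A" for \<K>
    unfolding L_def
  proof (intro conjI ballI)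
    show "\<Union>\<K> \<subseteq> carrier (weil_group ab)" using K by (auto simp: L_def)
    fix w assume "w \<in> \<Union>\<K>"
    then obtain A where A: "A \<in> \<K>" "w \<in> A" by (elim UnionE)
    with K have "L A" by simp
    with A(2) obtain S where "finite S" "N w S \<subseteq> A" unfolding L_def by metis
    then show "\<exists>S. finite S \<and> N w S \<subseteq> \<Union>\<K>" using A(1) by (intro exI[of _ S]) auto
  qed
  ultimately have "istopology L" unfolding istopology_def by simp
  then have "openin (topology L) U = L U" by (simp add: topology_inverse')
  then show ?thesis unfolding weil_topology_def L_def N_def .
qed


section \<open>The dual group and the $L$-group\<close>

definition galois_on_character ::
  "('f::field alg_closure^'m^'m) set \<Rightarrow> ('f alg_closure \<Rightarrow> 'f alg_closure) \<Rightarrow>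
   ('f alg_closure^'m^'m \<Rightarrow> 'f alg_closure) \<Rightarrow> 'f alg_closure^'m^'m \<Rightarrow> 'f alg_closure" where
  "galois_on_character T \<sigma> \<xi> = (\<lambda>t\<in>T. \<sigma> (\<xi> (map_matrix (inv_into UNIV \<sigma>) t)))"

text \<open>\<open>Gh\<close> with the action \<open>act\<close> of the Weil group is a dual group of the quasi-split group \<open>G\<close>:
  \<open>T \<subseteq> B\<close> are a maximal torus and a Borel subgroup of \<open>G\<close> over the base field, \<open>\<iota>\<close> and \<open>\<kappa>\<close> identify
  the dual of the based root datum of \<open>(G, B, T)\<close> with that of \<open>(Gh, Bh, Th)\<close>, and the Weil group
  acts by algebraic automorphisms which preserve the splitting \<open>(Bh, Th, {Y \<beta>})\<close> and induce on
  the cocharacters of \<open>Th\<close> the Galois action on the characters of \<open>T\<close>.\<close>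

definition is_dual_group ::
  "('f::field_char_0 \<Rightarrow> real) \<Rightarrow> ('f alg_closure^'m^'m) set \<Rightarrow> (complex^'n^'n) set \<Rightarrow>
   (('f alg_closure \<Rightarrow> 'f alg_closure) \<Rightarrow> complex^'n^'n \<Rightarrow> complex^'n^'n) \<Rightarrow> bool" where
  "is_dual_group ab G Gh act \<longleftrightarrow> connected_reductive UNIV Gh \<and>
     (\<exists>B T Bh Th \<iota> \<kappa> Y.
        borel_subgroup G B \<and> alg_group (range to_ac) B \<and>
        maximal_torus G T \<and> alg_group (range to_ac) T \<and> T \<subseteq> B \<and>
        borel_subgroup Gh Bh \<and> maximal_torus Gh Th \<and> Th \<subseteq> Bh \<and>
        \<iota> \<in> iso (character_group T) (cocharacter_group Th) \<and>
        \<kappa> \<in> iso (cocharacter_group T) (character_group Th) \<and>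
        (\<forall>\<xi> \<in> carrier (character_group T). \<forall>\<mu> \<in> carrier (cocharacter_group T).
           (\<forall>n. pairing \<xi> \<mu> n \<longleftrightarrow> pairing (\<kappa> \<mu>) (\<iota> \<xi>) n) \<and>
           (is_coroot G T \<xi> \<mu> \<longleftrightarrow> is_coroot Gh Th (\<kappa> \<mu>) (\<iota> \<xi>)) \<and>
           (is_coroot G T \<xi> \<mu> \<longrightarrow> (\<xi> \<in> simple_roots B T \<longleftrightarrow> \<kappa> \<mu> \<in> simple_roots Bh Th))) \<and>
        (\<forall>w \<in> carrier (weil_group ab).
           alg_hom Gh Gh (act w) \<and> bij_betw (act w) Gh Gh \<and>
           (\<forall>v \<in> carrier (weil_group ab). \<forall>g\<in>Gh. act (w \<circ> v) g = act w (act v g)) \<and>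
           act w ` Bh = Bh \<and> act w ` Th = Th \<and>
           differential Gh (act w) ` Y ` simple_roots Bh Th = Y ` simple_roots Bh Th \<and>
           (\<forall>\<xi> \<in> carrier (character_group T). \<forall>z. z \<noteq> 0 \<longrightarrow>
              \<iota> (galois_on_character T w \<xi>) z = act w (\<iota> \<xi> z))) \<and>
        (\<forall>\<beta> \<in> simple_roots Bh Th. Y \<beta> \<in> weight_space Gh Th \<beta> \<and> Y \<beta> \<noteq> 0))"

definition l_group ::
  "('f::field_char_0 \<Rightarrow> real) \<Rightarrow> (complex^'n^'n) set \<Rightarrow>
   (('f alg_closure \<Rightarrow> 'f alg_closure) \<Rightarrow> complex^'n^'n \<Rightarrow> complex^'n^'n) \<Rightarrow>
   ((complex^'n^'n) \<times> ('f alg_closure \<Rightarrow> 'f alg_closure)) monoid" where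
  "l_group ab Gh act = \<lparr>carrier = Gh \<times> carrier (weil_group ab),
     monoid.mult = (\<lambda>(g, w) (h, v). (g ** act w h, w \<circ> v)), one = (mat 1, id)\<rparr>"

definition l_topology ::
  "('f::field_char_0 \<Rightarrow> real) \<Rightarrow> (complex^'n^'n) set \<Rightarrow>
   ((complex^'n^'n) \<times> ('f alg_closure \<Rightarrow> 'f alg_closure)) topology" where
  "l_topology ab Gh = prod_topology (top_of_set Gh) (weil_topology ab)"

definition l_Ad ::
  "(complex^'n^'n) set \<Rightarrow>
   (('f alg_closure \<Rightarrow> 'f alg_closure) \<Rightarrow> complex^'n^'n \<Rightarrow> complex^'n^'n) \<Rightarrow>
   (complex^'n^'n) \<times> ('f::field_char_0 alg_closure \<Rightarrow> 'f alg_closure) \<Rightarrow> complex^'n^'n \<Rightarrow> complex^'n^'n" where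
  "l_Ad Gh act = (\<lambda>(g, w) Y. g ** differential Gh (act w) Y ** matrix_inv g)"

text \<open>Representations of the algebraic group \<open>Gh \<rtimes> Q\<close>, with \<open>Q\<close> the (finite) image of the Weil
  group in the automorphisms of \<open>Gh\<close>, inflated to the \<open>L\<close>-group.  The dimension \<open>N\<close> varies,
  so matrices are functions on pairs of indices below \<open>N\<close>.\<close>

definition l_rep ::
  "('f::field_char_0 \<Rightarrow> real) \<Rightarrow> (complex^'n^'n) set \<Rightarrow>
   (('f alg_closure \<Rightarrow> 'f alg_closure) \<Rightarrow> complex^'n^'n \<Rightarrow> complex^'n^'n) \<Rightarrow> nat \<Rightarrow>
   ((complex^'n^'n) \<times> ('f alg_closure \<Rightarrow> 'f alg_closure) \<Rightarrow> nat \<Rightarrow> nat \<Rightarrow> complex) \<Rightarrow> bool" where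
  "l_rep ab Gh act N r \<longleftrightarrow> (\<forall>i<N. \<forall>j<N.
     (\<forall>x \<in> carrier (l_group ab Gh act). \<forall>y \<in> carrier (l_group ab Gh act).
        r (x \<otimes>\<^bsub>l_group ab Gh act\<^esub> y) i j = (\<Sum>k<N. r x i k * r y k j)) \<and>
     (\<forall>w \<in> carrier (weil_group ab). (\<forall>g\<in>Gh. act w g = g) \<longrightarrow>
        r (mat 1, w) i j = (if i = j then 1 else 0)) \<and>
     (\<exists>f\<in>regular_fun. \<forall>g\<in>Gh. r (g, id) i j = f g))"

definition diagonalizable :: "nat \<Rightarrow> (nat \<Rightarrow> nat \<Rightarrow> complex) \<Rightarrow> bool" where
  "diagonalizable N A \<longleftrightarrow> (\<exists>P Q.
     (\<forall>i<N. \<forall>j<N. (\<Sum>k<N. P i k * Q k j) = (if i = j then 1 else 0)) \<and>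
     (\<forall>i<N. \<forall>j<N. i \<noteq> j \<longrightarrow> (\<Sum>k<N. \<Sum>l<N. P i k * A k l * Q l j) = 0))"

definition l_semisimple ::
  "('f::field_char_0 \<Rightarrow> real) \<Rightarrow> (complex^'n^'n) set \<Rightarrow>
   (('f alg_closure \<Rightarrow> 'f alg_closure) \<Rightarrow> complex^'n^'n \<Rightarrow> complex^'n^'n) \<Rightarrow>
   (complex^'n^'n) \<times> ('f alg_closure \<Rightarrow> 'f alg_closure) \<Rightarrow> bool" where
  "l_semisimple ab Gh act x \<longleftrightarrow> (\<forall>N r. l_rep ab Gh act N r \<longrightarrow> diagonalizable N (r x))"


section \<open>Infinitesimal parameters and Vogan varieties\<close>

definition infinitesimal_parameter ::
  "('f::field_char_0 \<Rightarrow> real) \<Rightarrow> (complex^'n^'n) set \<Rightarrow>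
   (('f alg_closure \<Rightarrow> 'f alg_closure) \<Rightarrow> complex^'n^'n \<Rightarrow> complex^'n^'n) \<Rightarrow>
   (('f alg_closure \<Rightarrow> 'f alg_closure) \<Rightarrow> (complex^'n^'n) \<times> ('f alg_closure \<Rightarrow> 'f alg_closure)) \<Rightarrow> bool" where
  "infinitesimal_parameter ab Gh act lam \<longleftrightarrow>
     lam \<in> hom (weil_group ab) (l_group ab Gh act) \<and>
     continuous_map (weil_topology ab) (l_topology ab Gh) lam \<and>
     (\<forall>w \<in> carrier (weil_group ab). snd (lam w) = w) \<and>
     (\<forall>w \<in> carrier (weil_group ab). frob_degree ab w 1 \<longrightarrow> l_semisimple ab Gh act (lam w))"

definition vogan_V ::
  "('f::field_char_0 \<Rightarrow> real) \<Rightarrow> (complex^'n^'n) set \<Rightarrow>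
   (('f alg_closure \<Rightarrow> 'f alg_closure) \<Rightarrow> complex^'n^'n \<Rightarrow> complex^'n^'n) \<Rightarrow>
   (('f alg_closure \<Rightarrow> 'f alg_closure) \<Rightarrow> (complex^'n^'n) \<times> ('f alg_closure \<Rightarrow> 'f alg_closure)) \<Rightarrow>
   (complex^'n^'n) set" where
  "vogan_V ab Gh act lam = {x \<in> lie_alg Gh. \<forall>w \<in> carrier (weil_group ab).
     l_Ad Gh act (lam w) x = weil_norm ab w *\<^sub>R x}"

definition vogan_V_dual ::
  "('f::field_char_0 \<Rightarrow> real) \<Rightarrow> (complex^'n^'n) set \<Rightarrow>
   (('f alg_closure \<Rightarrow> 'f alg_closure) \<Rightarrow> complex^'n^'n \<Rightarrow> complex^'n^'n) \<Rightarrow>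
   (('f alg_closure \<Rightarrow> 'f alg_closure) \<Rightarrow> (complex^'n^'n) \<times> ('f alg_closure \<Rightarrow> 'f alg_closure)) \<Rightarrow>
   (complex^'n^'n) set" where
  "vogan_V_dual ab Gh act lam = {y \<in> lie_alg Gh. \<forall>w \<in> carrier (weil_group ab).
     l_Ad Gh act (lam w) y = inverse (weil_norm ab w) *\<^sub>R y}"

definition vogan_H ::
  "('f::field_char_0 \<Rightarrow> real) \<Rightarrow> (complex^'n^'n) set \<Rightarrow>
   (('f alg_closure \<Rightarrow> 'f alg_closure) \<Rightarrow> complex^'n^'n \<Rightarrow> complex^'n^'n) \<Rightarrow>
   (('f alg_closure \<Rightarrow> 'f alg_closure) \<Rightarrow> (complex^'n^'n) \<times> ('f alg_closure \<Rightarrow> 'f alg_closure)) \<Rightarrow>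
   (complex^'n^'n) set" where
  "vogan_H ab Gh act lam = {h \<in> Gh. \<forall>w \<in> carrier (weil_group ab).
     (h, id) \<otimes>\<^bsub>l_group ab Gh act\<^esub> lam w = lam w \<otimes>\<^bsub>l_group ab Gh act\<^esub> (h, id)}"

definition conj_orbits :: "(complex^'n^'n) set \<Rightarrow> (complex^'n^'n) set \<Rightarrow> (complex^'n^'n) set set" where
  "conj_orbits H V = orbits (matgrp H) V (\<lambda>h x. h ** x ** matrix_inv h)"

definition open_orbit ::
  "(complex^'n^'n) set \<Rightarrow> (complex^'n^'n) set \<Rightarrow> (complex^'n^'n) set \<Rightarrow> bool" where
  "open_orbit H V C \<longleftrightarrow> C \<in> conj_orbits H V \<and> openin (subtopology (zariski entries) V) C"

definition closed_orbit ::
  "(complex^'n^'n) set \<Rightarrow> (complex^'n^'n) set \<Rightarrow> (complex^'n^'n) set \<Rightarrow> bool" where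
  "closed_orbit H V C \<longleftrightarrow> C \<in> conj_orbits H V \<and> closedin (subtopology (zariski entries) V) C"


section \<open>Pyasetskii duality\<close>

text \<open>\<open>conormal C V'\<close> is \<open>\<Lambda>\<^sub>C\<close> for an orbit \<open>C\<close> in \<open>V\<close> and \<open>V'\<close> the dual space, and \<open>\<Lambda>*\<^sub>C\<close> for an orbit
  \<open>C\<close> in the dual space and \<open>V'\<close> the space \<open>V\<close>; the closures are taken in the product of the
  two spaces.\<close>

definition conormal ::
  "(complex^'n^'n) set \<Rightarrow> (complex^'n^'n) set \<Rightarrow> ((complex^'n^'n) \<times> (complex^'n^'n)) set" where
  "conormal C V' = {(x, y) \<in> C \<times> V'. x ** y - y ** x = 0}"

definition orbit_duality ::
  "(complex^'n^'n) set \<Rightarrow> (complex^'n^'n) set \<Rightarrow> (complex^'n^'n) set \<Rightarrow>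
   ((complex^'n^'n) set \<Rightarrow> (complex^'n^'n) set) \<Rightarrow> bool" where
  "orbit_duality H V V' star \<longleftrightarrow> bij_betw star (conj_orbits H V) (conj_orbits H V') \<and>
     (\<forall>C \<in> conj_orbits H V.
        prod.swap ` (subtopology (zariski entries2) (V \<times> V') closure_of conormal C V') =
        subtopology (zariski entries2) (V' \<times> V) closure_of conormal (star C) V)"

end

theory Submission
  imports Defs
begin

text \<open>
  The origin lies in both spaces.  For every orbit \<open>C\<close> and \<open>x \<in> C\<close> the pair \<open>(x, 0)\<close> lies in the
  conormal variety of \<open>C\<close>, so the duality places \<open>(0, y)\<close> in the closure of \<open>\<Lambda>\<^sub>C\<close> for every
  \<open>y\<close> in the dual orbit.  If \<open>C\<close> is closed, this closure stays over \<open>C\<close>; hence \<open>0 \<in> C\<close> and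
  \<open>C = {0}\<close>.  Its conormal variety is then \<open>{0} \<times> V'\<close>, and the duality forces the dual orbit to be
  dense in \<open>V'\<close>, so it meets, and therefore equals, any open orbit.  The other half follows because
  the inverse of the duality is the duality with the two spaces exchanged.
\<close>

section \<open>Zariski topology\<close>

lemma topspace_zariski [simp]: "topspace (zariski E) = UNIV"
proof -
  have "openin (zariski E) UNIV"
    unfolding openin_zariski
    by (rule exI[of _ "{\<lambda>_. 1}"]) (auto intro: poly_fun.const)
  then show ?thesis using openin_subset by blast
qed

lemma poly_fun_comp:
  assumes "p \<in> poly_fun K F" and "\<And>e. e \<in> F \<Longrightarrow> (\<lambda>x. e (f x)) \<in> poly_fun K E"
  shows "(\<lambda>x. p (f x)) \<in> poly_fun K E"
  using assms(1) by induction (auto intro: poly_fun.intros assms(2))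

text \<open>The preimage of the nonvanishing locus of a family is the nonvanishing locus of the
  pulled-back family, so testing the coordinates in \<open>F\<close> suffices.\<close>

lemma continuous_map_zariski:
  assumes "\<And>e. e \<in> F \<Longrightarrow> (\<lambda>x. e (f x)) \<in> poly_fun UNIV E"
  shows "continuous_map (zariski E) (zariski F) f"
proof -
  have "openin (zariski E) {x. f x \<in> U}" if U: "openin (zariski F) U" for U
  proof -
    obtain P where P: "P \<subseteq> poly_fun UNIV F" "U = {x. \<exists>p\<in>P. p x \<noteq> 0}"
      using U unfolding openin_zariski by (elim exE conjE)
    have "(\<lambda>p x. p (f x)) ` P \<subseteq> poly_fun UNIV E"
    proof (rule image_subsetI)
      fix p assume "p \<in> P"
      then have "p \<in> poly_fun UNIV F" using P(1) by (rule subsetD[rotated])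
      then show "(\<lambda>x. p (f x)) \<in> poly_fun UNIV E" by (rule poly_fun_comp) (rule assms)
    qed
    moreover have "{x. f x \<in> U} = {x. \<exists>q\<in>(\<lambda>p x. p (f x)) ` P. q x \<noteq> 0}"
      by (simp add: P(2))
    ultimately show ?thesis unfolding openin_zariski by (intro exI conjI)
  qed
  then show ?thesis by (simp add: continuous_map_def)
qed

lemma continuous_map_zariski_fst: "continuous_map (zariski entries2) (zariski entries) fst"
  by (rule continuous_map_zariski, rule poly_fun.gen) (auto simp: entries2_def comp_def)

text \<open>The topology given by \<open>entries2\<close> is in general finer than the product
  topology. This projection links it to the factor \<open>V\<close>: it pulls a set \<open>C\<close>
  in \<open>V\<close> back to \<open>C \<times> W\<close>.\<close>

lemma continuous_map_subtopology_zariski_fst: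
  "continuous_map (subtopology (zariski entries2) (V \<times> W)) (subtopology (zariski entries) V) fst"
  by (intro continuous_map_into_subtopology continuous_map_from_subtopology
      continuous_map_zariski_fst) auto

lemma in_closure_of_subtopology_zariski:
  assumes "x \<in> S" "x \<in> A"
  shows "x \<in> subtopology (zariski E) A closure_of S"
  using assms closure_of_subset_Int[of "subtopology (zariski E) A" S] by auto

section \<open>Matrix groups and orbits\<close>

lemma matrix_inv_cancel:
  fixes A :: "'k::field^'n^'n"
  assumes "invertible A"
  shows "A ** matrix_inv A = mat 1" "matrix_inv A ** A = mat 1"
proof -
  have "\<exists>B. A ** B = mat 1 \<and> B ** A = mat 1" using assms unfolding invertible_def .
  then have "A ** matrix_inv A = mat 1 \<and> matrix_inv A ** A = mat 1"
    unfolding matrix_inv_def by (rule someI_ex)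
  then show "A ** matrix_inv A = mat 1" "matrix_inv A ** A = mat 1" by auto
qed

lemma matrix_inv_eqI:
  fixes A :: "'k::field^'n^'n"
  assumes "A ** B = mat 1" "B ** A = mat 1"
  shows "matrix_inv A = B"
proof -
  have "invertible A" using assms invertible_def by blast
  then have "matrix_inv A = matrix_inv A ** (A ** B)" using assms by simp
  also have "\<dots> = B" using matrix_inv_cancel[OF \<open>invertible A\<close>] by (simp add: matrix_mul_assoc)
  finally show ?thesis .
qed

lemma matrix_inv_mult:
  fixes A B :: "'k::field^'n^'n"
  assumes A: "invertible A" and B: "invertible B"
  shows "matrix_inv (A ** B) = matrix_inv B ** matrix_inv A"
proof (rule matrix_inv_eqI)
  have "A ** B ** (matrix_inv B ** matrix_inv A) = A ** (B ** matrix_inv B) ** matrix_inv A"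
    by (simp add: matrix_mul_assoc)
  then show "A ** B ** (matrix_inv B ** matrix_inv A) = mat 1"
    using matrix_inv_cancel[OF A] matrix_inv_cancel[OF B] by simp
  have "matrix_inv B ** matrix_inv A ** (A ** B) = matrix_inv B ** (matrix_inv A ** A) ** B"
    by (simp add: matrix_mul_assoc)
  then show "matrix_inv B ** matrix_inv A ** (A ** B) = mat 1"
    using matrix_inv_cancel[OF A] matrix_inv_cancel[OF B] by simp
qed

lemma invertible_matrix_inv:
  fixes A :: "'k::field^'n^'n"
  assumes "invertible A"
  shows "invertible (matrix_inv A)"
  using matrix_inv_cancel[OF assms] unfolding invertible_def by blast

text \<open>The group laws are phrased with \<open>matrix_inv\<close>, the inverse occurring in
  \<open>conj_orbits\<close>, so that algebraic groups and the centralizer \<open>vogan_H\<close>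
  are treated alike.\<close>

definition matrix_subgroup :: "('k::field^'n^'n) set \<Rightarrow> bool" where
  "matrix_subgroup H \<longleftrightarrow> (\<forall>h\<in>H. invertible h \<and> matrix_inv h \<in> H) \<and> mat 1 \<in> H \<and>
     (\<forall>g\<in>H. \<forall>h\<in>H. g ** h \<in> H)"

lemma group_GL: "Group.group (matgrp {A :: 'k::field^'n^'n. invertible A})"
proof (rule groupI)
  fix A :: "'k^'n^'n" assume "A \<in> carrier (matgrp {A. invertible A})"
  then show "\<exists>B\<in>carrier (matgrp {A. invertible A}).
      B \<otimes>\<^bsub>matgrp {A. invertible A}\<^esub> A = \<one>\<^bsub>matgrp {A. invertible A}\<^esub>"
    by (intro bexI[of _ "matrix_inv A"]) (auto simp: matgrp_def matrix_inv_cancel invertible_matrix_inv)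
qed (auto simp: matgrp_def invertible_mult matrix_mul_assoc invertible_def[of "mat 1"])

lemma alg_group_matrix_subgroup:
  assumes "alg_group K H"
  shows "matrix_subgroup H"
proof -
  let ?GL = "matgrp {A :: 'a^'n^'n. invertible A}"
  interpret GL: Group.group ?GL by (rule group_GL)
  have H: "subgroup H ?GL" using assms by (simp add: alg_group_def)
  have inv: "invertible h" if "h \<in> H" for h
    using subgroup.subset[OF H] that by (auto simp: matgrp_def)
  have "matrix_inv h \<in> H" if h: "h \<in> H" for h
  proof -
    have "matrix_inv h = inv\<^bsub>?GL\<^esub> h"
      using inv[OF h] by (intro GL.inv_equality[symmetric])
        (auto simp: matgrp_def matrix_inv_cancel invertible_matrix_inv)
    then show ?thesis using subgroup.m_inv_closed[OF H h] by simp
  qed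
  then show ?thesis
    using inv subgroup.one_closed[OF H] subgroup.m_closed[OF H]
    by (auto simp: matrix_subgroup_def matgrp_def)
qed

lemma conj_orbits_iff:
  "C \<in> conj_orbits H V \<longleftrightarrow> (\<exists>x\<in>V. C = (\<lambda>h. h ** x ** matrix_inv h) ` H)"
  unfolding conj_orbits_def orbits_def orbit_def matgrp_def by auto

text \<open>Conjugation by \<open>h\<close> and then by \<open>k\<close> is conjugation by
  \<open>k ** h\<close>, which gives one inclusion; returning from \<open>y\<close> to
  \<open>x\<close> by \<open>matrix_inv h\<close> gives the other.\<close>

lemma conj_orbit_eq:
  assumes H: "matrix_subgroup H" and y: "y \<in> (\<lambda>h. h ** x ** matrix_inv h) ` H"
  shows "(\<lambda>h. h ** x ** matrix_inv h) ` H = (\<lambda>h. h ** y ** matrix_inv h) ` H"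
proof -
  have sub: "(\<lambda>h. h ** b ** matrix_inv h) ` H \<subseteq> (\<lambda>h. h ** a ** matrix_inv h) ` H"
    if "h \<in> H" "b = h ** a ** matrix_inv h" for a b h
  proof (rule image_subsetI)
    fix k assume "k \<in> H"
    then have "k ** b ** matrix_inv k = (k ** h) ** a ** matrix_inv (k ** h)" "k ** h \<in> H"
      using H that by (auto simp: matrix_subgroup_def matrix_inv_mult matrix_mul_assoc)
    then show "k ** b ** matrix_inv k \<in> (\<lambda>h. h ** a ** matrix_inv h) ` H" by blast
  qed
  obtain h where h: "h \<in> H" "y = h ** x ** matrix_inv h" using y by blast
  have h': "matrix_inv h \<in> H" "invertible h" using H h by (auto simp: matrix_subgroup_def)
  have "matrix_inv h ** y ** matrix_inv (matrix_inv h) = matrix_inv h ** y ** h"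
    using matrix_inv_cancel[OF h'(2)] matrix_inv_eqI by metis
  also have "\<dots> = (matrix_inv h ** h) ** x ** (matrix_inv h ** h)"
    by (simp add: h(2) matrix_mul_assoc)
  also have "\<dots> = x" using matrix_inv_cancel[OF h'(2)] by simp
  finally show ?thesis using sub[OF h] sub[OF h'(1), of x y] by auto
qed

text \<open>Membership in \<open>conj_orbits H V\<close> only provides a base point in
  \<open>V\<close>; invariance of \<open>V\<close> under \<open>H\<close> is not at hand, hence an
  intersection instead of an inclusion.\<close>

lemma conj_orbits_meet:
  fixes V :: "(complex^'n^'n) set"
  assumes H: "matrix_subgroup H" and "C \<in> conj_orbits H V"
  shows "C \<inter> V \<noteq> {}"
proof -
  obtain x where x: "x \<in> V" "C = (\<lambda>h. h ** x ** matrix_inv h) ` H"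
    using assms unfolding conj_orbits_iff by blast
  have "matrix_inv (mat 1 :: complex^'n^'n) = mat 1" by (rule matrix_inv_eqI) simp_all
  then have "x \<in> C"
    using H unfolding x(2) by (intro image_eqI[of _ _ "mat 1"]) (auto simp: matrix_subgroup_def)
  then show ?thesis using x(1) by blast
qed

lemma conj_orbits_disjoint:
  assumes "matrix_subgroup H" "C \<in> conj_orbits H V" "D \<in> conj_orbits H W" "C \<inter> D \<noteq> {}"
  shows "C = D"
  using assms conj_orbit_eq[OF assms(1)] unfolding conj_orbits_iff by blast

section \<open>Duality of open and closed orbits\<close>

text \<open>Lets the duality be applied to one pair at a time and in both directions.\<close>

lemma swap_in_orbit_duality_closure:
  assumes "orbit_duality H V V' star" and C: "C \<in> conj_orbits H V"
  shows "(y, x) \<in> subtopology (zariski entries2) (V' \<times> V) closure_of conormal (star C) V \<longleftrightarrow>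
    (x, y) \<in> subtopology (zariski entries2) (V \<times> V') closure_of conormal C V'"
proof -
  have "prod.swap ` (subtopology (zariski entries2) (V \<times> V') closure_of conormal C V') =
        subtopology (zariski entries2) (V' \<times> V) closure_of conormal (star C) V"
    using assms by (simp add: orbit_duality_def)
  then show ?thesis by force
qed

lemma orbit_duality_inv_into:
  assumes d: "orbit_duality H V V' star"
  shows "orbit_duality H V' V (inv_into (conj_orbits H V) star)"
  unfolding orbit_duality_def
proof (intro conjI ballI)
  have b: "bij_betw star (conj_orbits H V) (conj_orbits H V')"
    using d by (simp add: orbit_duality_def)
  then show "bij_betw (inv_into (conj_orbits H V) star) (conj_orbits H V') (conj_orbits H V)"
    by (rule bij_betw_inv_into)
  fix D assume D: "D \<in> conj_orbits H V'"
  let ?C = "inv_into (conj_orbits H V) star D"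
  have C: "?C \<in> conj_orbits H V" "star ?C = D"
    using b D by (auto simp: bij_betw_def inv_into_into f_inv_into_f)
  \<comment> \<open>Swapping is an involution, so the pointwise equivalence at \<open>?C\<close>,
    whose dual is \<open>D\<close>, can be read from right to left.\<close>
  show "prod.swap ` (subtopology (zariski entries2) (V' \<times> V) closure_of conormal D V) =
      subtopology (zariski entries2) (V \<times> V') closure_of conormal ?C V'"
    using swap_in_orbit_duality_closure[OF d C(1)] unfolding C(2)
    by (simp only: set_eq_iff split_paired_All pair_in_swap_image) simp
qed

lemma closed_orbit_eq_singleton_zero:
  assumes H: "matrix_subgroup H" and V: "0 \<in> V" and C: "closed_orbit H V C"
    and d: "orbit_duality H V V' star"
  shows "C = {0}"
proof -
  have CO: "C \<in> conj_orbits H V" and cl: "closedin (subtopology (zariski entries) V) C"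
    using C by (auto simp: closed_orbit_def)
  have S: "star C \<in> conj_orbits H V'"
    using d CO by (auto simp: orbit_duality_def bij_betw_def)
  obtain y where y: "y \<in> star C" "y \<in> V'" using conj_orbits_meet[OF H S] by blast
  let ?X = "subtopology (zariski entries2) (V \<times> V')"
  have "(y, 0) \<in> conormal (star C) V" using y V by (auto simp: conormal_def)
  then have "(y, 0) \<in> subtopology (zariski entries2) (V' \<times> V) closure_of conormal (star C) V"
    using y V by (intro in_closure_of_subtopology_zariski) auto
  then have "(0, y) \<in> ?X closure_of conormal C V'"
    by (simp only: swap_in_orbit_duality_closure[OF d CO])
  \<comment> \<open>The part of the product over \<open>C\<close> is closed and contains the
    conormal variety, hence also its closure.\<close>
  moreover have "closedin ?X {z \<in> topspace ?X. fst z \<in> C}"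
    by (rule closedin_continuous_map_preimage[OF continuous_map_subtopology_zariski_fst cl])
  moreover have "conormal C V' \<subseteq> {z \<in> topspace ?X. fst z \<in> C}"
    using closedin_subset[OF cl] by (auto simp: conormal_def)
  ultimately have "(0, y) \<in> {z \<in> topspace ?X. fst z \<in> C}"
    by (meson closure_of_minimal subsetD)
  then have "0 \<in> C" by simp
  moreover obtain x where x: "C = (\<lambda>h. h ** x ** matrix_inv h) ` H"
    using CO unfolding conj_orbits_iff by blast
  \<comment> \<open>An orbit can be rebased at any of its points; at the origin conjugation does
    nothing.\<close>
  ultimately have "C = (\<lambda>h. h ** 0 ** matrix_inv h) ` H"
    using conj_orbit_eq[OF H, of 0 x] by simp
  also have "\<dots> = (\<lambda>_. 0) ` H" by simp
  finally show ?thesis using H by (auto simp: matrix_subgroup_def)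
qed

lemma dual_of_closed_orbit:
  assumes H: "matrix_subgroup H" and V: "0 \<in> V"
    and C: "closed_orbit H V C" and D: "open_orbit H V' D"
    and d: "orbit_duality H V V' star"
  shows "star C = D"
proof -
  have CO: "C \<in> conj_orbits H V" using C by (auto simp: closed_orbit_def)
  have DO: "D \<in> conj_orbits H V'" and op: "openin (subtopology (zariski entries) V') D"
    using D by (auto simp: open_orbit_def)
  have S: "star C \<in> conj_orbits H V'"
    using d CO by (auto simp: orbit_duality_def bij_betw_def)
  obtain y where y: "y \<in> D" using conj_orbits_meet[OF H DO] by blast
  have yV: "y \<in> V'" using y openin_subset[OF op] by auto
  let ?X = "subtopology (zariski entries2) (V' \<times> V)"
  have C0: "C = {0}" by (rule closed_orbit_eq_singleton_zero[OF H V C d])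
  \<comment> \<open>With \<open>C\<close> reduced to the origin the commutator condition is vacuous,
    so any \<open>y\<close> in \<open>V'\<close> is allowed, in particular one in
    \<open>D\<close>.\<close>
  have "(0, y) \<in> conormal C V'" using C0 yV by (auto simp: conormal_def)
  then have "(0, y) \<in> subtopology (zariski entries2) (V \<times> V') closure_of conormal C V'"
    using yV V by (intro in_closure_of_subtopology_zariski) auto
  then have "(y, 0) \<in> ?X closure_of conormal (star C) V"
    by (simp only: swap_in_orbit_duality_closure[OF d CO])
  moreover have "(y, 0) \<in> {z \<in> topspace ?X. fst z \<in> D}" using y yV V by simp
  ultimately have "{z \<in> topspace ?X. fst z \<in> D} \<inter> ?X closure_of conormal (star C) V \<noteq> {}"
    by (intro notI) (drule equalityD1, drule subsetD, rule IntI, assumption+, simp)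
  \<comment> \<open>An open set that meets a closure meets the set itself, and the part of the
    product over \<open>D\<close> is open.\<close>
  then have "{z \<in> topspace ?X. fst z \<in> D} \<inter> conormal (star C) V \<noteq> {}"
    by (simp only: openin_Int_closure_of_eq_empty[OF
          openin_continuous_map_preimage[OF continuous_map_subtopology_zariski_fst op]] simp_thms)
  then obtain z where z: "fst z \<in> D" "z \<in> conormal (star C) V" by blast
  from z(2) have "fst z \<in> star C" by (simp add: conormal_def case_prod_unfold)
  with z(1) have "star C \<inter> D \<noteq> {}" by blast
  then show ?thesis by (rule conj_orbits_disjoint[OF H S DO])
qed

section \<open>The Vogan variety\<close>

text \<open>In the zero direction every polynomial is constant in \<open>t\<close>, so its linear
  coefficient vanishes.\<close>

lemma zero_in_lie_alg: "0 \<in> lie_alg G"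
  unfolding lie_alg_def
proof (intro CollectI ballI impI)
  fix p :: "'a^'b^'b \<Rightarrow> 'a"
  show "\<exists>f. (\<forall>t. p (mat 1 + mat t ** 0) = Polynomial.poly f t) \<and> Polynomial.coeff f 1 = 0"
    by (intro exI[of _ "[:p (mat 1):]"]) simp
qed

text \<open>The value of the \<open>THE\<close> needs existence and uniqueness. An extension
  \<open>f\<close> exists because \<open>\<phi>\<close> is algebraic, and every extension is
  constant along the zero direction, so only \<open>0\<close> can be the derivative.\<close>

lemma differential_zero:
  assumes "alg_hom G H \<phi>"
  shows "differential G \<phi> 0 = 0"
  unfolding differential_def
proof (rule the_equality)
  show "\<forall>i j. \<exists>f\<in>regular_fun. (\<forall>g\<in>G. \<phi> g $ i $ j = f g) \<and>
     ((\<lambda>t. f (mat 1 + mat t ** 0)) has_field_derivative (0 :: complex^'a^'a) $ i $ j) (at 0)"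
    using assms unfolding alg_hom_def by simp
next
  fix Z
  assume *: "\<forall>i j. \<exists>f\<in>regular_fun. (\<forall>g\<in>G. \<phi> g $ i $ j = f g) \<and>
     ((\<lambda>t. f (mat 1 + mat t ** 0)) has_field_derivative Z $ i $ j) (at 0)"
  have "Z $ i $ j = 0" for i j
  proof -
    obtain f where "((\<lambda>t::complex. f (mat 1 + mat t ** (0 :: complex^'a^'a)) :: complex)
        has_field_derivative Z $ i $ j) (at 0)"
      using * by blast
    then show ?thesis using DERIV_unique[OF _ DERIV_const] by simp
  qed
  then show "Z = 0" by (simp add: vec_eq_iff)
qed

text \<open>The identity has Frobenius degree \<open>0\<close>: the difference to be tested is
  \<open>x - x\<close>, so it is enough that \<open>0\<close> lies in the maximal ideal.\<close>

lemma id_in_weil_group: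
  assumes "p_adic_field ab"
  shows "id \<in> carrier (weil_group ab)"
proof -
  have p: "\<forall>x. ab x = 0 \<longleftrightarrow> x = 0" "\<forall>x y. ab (x * y) = ab x * ab y"
    using assms unfolding p_adic_field_def by auto
  then have ab: "ab 0 = 0" "ab 1 = 1"
    by (metis, metis mult.right_neutral mult_cancel_left1 zero_neq_one)
  \<comment> \<open>The monic polynomial X witnesses that its root \<open>0\<close> is
    integral.\<close>
  have "ab (Polynomial.coeff [:0, 1:] i) \<le> 1" for i
    using ab by (auto simp: coeff_pCons split: nat.split)
  then have "0 \<in> integers_ac ab"
    unfolding integers_ac_def by (intro CollectI exI[of _ "[:0, 1:]"]) (auto simp: map_poly_pCons)
  then have "frob_degree ab id 0" by (simp add: frob_degree_def max_ideal_ac_def)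
  then show ?thesis by (auto simp: weil_group_def galois_def)
qed

lemma alg_hom_mult:
  assumes "alg_hom G H \<phi>" "g \<in> G" "h \<in> G"
  shows "\<phi> (g ** h) = \<phi> g ** \<phi> h"
  using assms by (auto simp: alg_hom_def hom_def matgrp_def)

text \<open>\<open>hom\<close> demands multiplicativity only, but an invertible idempotent matrix is
  the identity.\<close>

lemma alg_hom_one:
  assumes "alg_hom G H \<phi>" "matrix_subgroup G" "matrix_subgroup H"
  shows "\<phi> (mat 1) = mat 1"
proof -
  have 1: "mat 1 \<in> G" using assms by (simp add: matrix_subgroup_def)
  then have "\<phi> (mat 1) \<in> H" using assms by (auto simp: alg_hom_def hom_def matgrp_def)
  then have inv: "invertible (\<phi> (mat 1))" using assms by (simp add: matrix_subgroup_def)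
  have "\<phi> (mat 1) = matrix_inv (\<phi> (mat 1)) ** (\<phi> (mat 1) ** \<phi> (mat 1))"
    using matrix_inv_cancel[OF inv] by (simp add: matrix_mul_assoc)
  also have "\<phi> (mat 1) ** \<phi> (mat 1) = \<phi> (mat 1)"
    using alg_hom_mult[OF assms(1) 1 1] by simp
  finally show ?thesis using matrix_inv_cancel[OF inv] by simp
qed

text \<open>Collects the consequences of \<open>is_dual_group\<close> and
  \<open>infinitesimal_parameter\<close> from which the group and the two spaces are
  studied.\<close>

locale vogan_setup =
  fixes ab :: "'f::field_char_0 \<Rightarrow> real"
    and Gh :: "(complex^'n^'n) set"
    and act :: "('f alg_closure \<Rightarrow> 'f alg_closure) \<Rightarrow> complex^'n^'n \<Rightarrow> complex^'n^'n"
    and lam :: "('f alg_closure \<Rightarrow> 'f alg_closure) \<Rightarrow>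
                  (complex^'n^'n) \<times> ('f alg_closure \<Rightarrow> 'f alg_closure)"
  assumes Gh: "matrix_subgroup Gh"
    and act_alg_hom: "\<And>w. w \<in> carrier (weil_group ab) \<Longrightarrow> alg_hom Gh Gh (act w)"
    and act_id: "\<And>g. g \<in> Gh \<Longrightarrow> act id g = g"
    and lam: "\<And>w. w \<in> carrier (weil_group ab) \<Longrightarrow> fst (lam w) \<in> Gh \<and> snd (lam w) = w"
begin

lemma l_Ad_lam_zero:
  "w \<in> carrier (weil_group ab) \<Longrightarrow> l_Ad Gh act (lam w) 0 = 0"
  using differential_zero[OF act_alg_hom] lam[of w]
  by (auto simp: l_Ad_def split: prod.splits)

lemma zero_in_vogan_V: "0 \<in> vogan_V ab Gh act lam"
  by (simp add: vogan_V_def zero_in_lie_alg l_Ad_lam_zero)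

lemma zero_in_vogan_V_dual: "0 \<in> vogan_V_dual ab Gh act lam"
  by (simp add: vogan_V_dual_def zero_in_lie_alg l_Ad_lam_zero)

text \<open>The Weil components of both products are \<open>w\<close>, and \<open>act id\<close> is
  trivial on \<open>Gh\<close>; what remains is a centralizer condition twisted by
  \<open>act w\<close>.\<close>

lemma vogan_H_iff:
  "h \<in> vogan_H ab Gh act lam \<longleftrightarrow>
     h \<in> Gh \<and> (\<forall>w \<in> carrier (weil_group ab). h ** fst (lam w) = fst (lam w) ** act w h)"
proof -
  have "(h, id) \<otimes>\<^bsub>l_group ab Gh act\<^esub> lam w = lam w \<otimes>\<^bsub>l_group ab Gh act\<^esub> (h, id) \<longleftrightarrow>
      h ** fst (lam w) = fst (lam w) ** act w h" if "w \<in> carrier (weil_group ab)" for w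
    using lam[OF that] act_id by (cases "lam w") (auto simp: l_group_def)
  then show ?thesis by (auto simp: vogan_H_def)
qed

lemma vogan_H_matrix_subgroup: "matrix_subgroup (vogan_H ab Gh act lam)"
  unfolding matrix_subgroup_def
proof (intro conjI ballI)
  show "mat 1 \<in> vogan_H ab Gh act lam"
    using Gh alg_hom_one[OF act_alg_hom Gh Gh] by (simp add: vogan_H_iff matrix_subgroup_def)
next
  fix g h assume "g \<in> vogan_H ab Gh act lam" "h \<in> vogan_H ab Gh act lam"
  then have g: "g \<in> Gh" "\<And>w. w \<in> carrier (weil_group ab) \<Longrightarrow> g ** fst (lam w) = fst (lam w) ** act w g"
    and h: "h \<in> Gh" "\<And>w. w \<in> carrier (weil_group ab) \<Longrightarrow> h ** fst (lam w) = fst (lam w) ** act w h"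
    by (simp_all add: vogan_H_iff)
  have "g ** h ** fst (lam w) = fst (lam w) ** act w (g ** h)" if w: "w \<in> carrier (weil_group ab)" for w
  proof -
    have "g ** h ** fst (lam w) = g ** (h ** fst (lam w))" by (simp add: matrix_mul_assoc)
    also have "\<dots> = (g ** fst (lam w)) ** act w h" using h(2)[OF w] by (simp add: matrix_mul_assoc)
    also have "\<dots> = fst (lam w) ** (act w g ** act w h)"
      using g(2)[OF w] by (simp add: matrix_mul_assoc)
    finally show ?thesis using alg_hom_mult[OF act_alg_hom[OF w] g(1) h(1)] by simp
  qed
  then show "g ** h \<in> vogan_H ab Gh act lam"
    using Gh g h by (simp add: vogan_H_iff matrix_subgroup_def)
next
  fix h assume "h \<in> vogan_H ab Gh act lam"
  then have h: "h \<in> Gh" "\<And>w. w \<in> carrier (weil_group ab) \<Longrightarrow> h ** fst (lam w) = fst (lam w) ** act w h"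
    by (simp_all add: vogan_H_iff)
  have inv: "invertible h" "matrix_inv h \<in> Gh" using Gh h by (simp_all add: matrix_subgroup_def)
  show "invertible h" by fact
  have "matrix_inv h ** fst (lam w) = fst (lam w) ** act w (matrix_inv h)"
    if w: "w \<in> carrier (weil_group ab)" for w
  proof -
    have 1: "act w h ** act w (matrix_inv h) = mat 1"
      using alg_hom_mult[OF act_alg_hom[OF w] h(1) inv(2)] alg_hom_one[OF act_alg_hom[OF w] Gh Gh]
        matrix_inv_cancel[OF inv(1)] by simp
    \<comment> \<open>The identity is inserted on the right as
      \<open>act w h ** act w (matrix_inv h)\<close>, so that the twisted relation for
      \<open>h\<close> can move \<open>h\<close> to the left, where it cancels.\<close>
    have "matrix_inv h ** fst (lam w) =
        matrix_inv h ** (fst (lam w) ** act w h) ** act w (matrix_inv h)"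
      using 1 by (simp add: matrix_mul_assoc[symmetric])
    also have "\<dots> = (matrix_inv h ** h) ** fst (lam w) ** act w (matrix_inv h)"
      by (simp add: matrix_mul_assoc h(2)[OF w, symmetric])
    finally show ?thesis using matrix_inv_cancel[OF inv(1)] by simp
  qed
  then show "matrix_inv h \<in> vogan_H ab Gh act lam" using inv by (simp add: vogan_H_iff)
qed

end

lemma vogan_setupI:
  assumes p: "p_adic_field ab" and dual: "is_dual_group ab G Gh act"
    and par: "infinitesimal_parameter ab Gh act lam"
  shows "vogan_setup ab Gh act lam"
proof
  show "matrix_subgroup Gh"
    using dual by (auto simp: is_dual_group_def connected_reductive_def intro: alg_group_matrix_subgroup)
  have act: "alg_hom Gh Gh (act w) \<and> bij_betw (act w) Gh Gh \<and>
      (\<forall>v \<in> carrier (weil_group ab). \<forall>g\<in>Gh. act (w \<circ> v) g = act w (act v g))"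
    if "w \<in> carrier (weil_group ab)" for w
    using dual that unfolding is_dual_group_def by (elim conjE exE) (drule (1) bspec, simp)
  then show "alg_hom Gh Gh (act w)" if "w \<in> carrier (weil_group ab)" for w
    using that by blast
  fix g assume g: "g \<in> Gh"
  note id = act[OF id_in_weil_group[OF p]]
  \<comment> \<open>\<open>is_dual_group\<close> states compatibility of the action with
    composition; this makes \<open>act id\<close> idempotent, and injectivity on \<open>Gh\<close>
    then makes it the identity there.\<close>
  then have "act id (act id g) = act id g" using id_in_weil_group[OF p] g by (metis comp_id)
  moreover have "act id g \<in> Gh" "inj_on (act id) Gh"
    using id g by (auto simp: bij_betw_def)
  ultimately show "act id g = g" using g by (simp add: inj_on_eq_iff)
next
  fix w assume w: "w \<in> carrier (weil_group ab)"
  then have "lam w \<in> carrier (l_group ab Gh act)" "snd (lam w) = w"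
    using par by (auto simp: infinitesimal_parameter_def hom_def)
  then show "fst (lam w) \<in> Gh \<and> snd (lam w) = w" by (auto simp: l_group_def)
qed

theorem proposition3p2:
  fixes ab :: "'f::field_char_0 \<Rightarrow> real"
    and G :: "('f alg_closure^'m^'m) set"
    and Gh :: "(complex^'n^'n) set"
    and act :: "('f alg_closure \<Rightarrow> 'f alg_closure) \<Rightarrow> complex^'n^'n \<Rightarrow> complex^'n^'n"
    and lam :: "('f alg_closure \<Rightarrow> 'f alg_closure) \<Rightarrow>
                  (complex^'n^'n) \<times> ('f alg_closure \<Rightarrow> 'f alg_closure)"
    and H V V' :: "(complex^'n^'n) set"
    and star :: "(complex^'n^'n) set \<Rightarrow> (complex^'n^'n) set"
  assumes "p_adic_field ab"
    and "connected_reductive (range to_ac) G"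
    and "quasi_split (range to_ac) G"
    and "is_dual_group ab G Gh act"
    and "infinitesimal_parameter ab Gh act lam"
    and "H = vogan_H ab Gh act lam"
    and "V = vogan_V ab Gh act lam"
    and "V' = vogan_V_dual ab Gh act lam"
    and "orbit_duality H V V' star"
  shows "(\<forall>C\<^sub>0 D. closed_orbit H V C\<^sub>0 \<and> open_orbit H V' D \<longrightarrow> star C\<^sub>0 = D) \<and>
         (\<forall>C D\<^sub>0. open_orbit H V C \<and> closed_orbit H V' D\<^sub>0 \<longrightarrow> star C = D\<^sub>0)"
proof -
  interpret vogan_setup ab Gh act lam
    by (rule vogan_setupI[OF assms(1,4,5)])
  have H: "matrix_subgroup H" and V: "0 \<in> V" and V': "0 \<in> V'"
    using assms(6-8) vogan_H_matrix_subgroup zero_in_vogan_V zero_in_vogan_V_dual by simp_all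
  note d = assms(9)
  show ?thesis
  proof (intro conjI allI impI)
    fix C\<^sub>0 D assume "closed_orbit H V C\<^sub>0 \<and> open_orbit H V' D"
    then show "star C\<^sub>0 = D" using dual_of_closed_orbit[OF H V _ _ d] by blast
  next
    fix C D\<^sub>0 assume *: "open_orbit H V C \<and> closed_orbit H V' D\<^sub>0"
    \<comment> \<open>The first half is applied to the inverse duality, which starts from the closed
      orbit in \<open>V'\<close>.\<close>
    then have "inv_into (conj_orbits H V) star D\<^sub>0 = C"
      using dual_of_closed_orbit[OF H V' _ _ orbit_duality_inv_into[OF d]] by blast
    moreover have "D\<^sub>0 \<in> star ` conj_orbits H V"
      using * d by (auto simp: closed_orbit_def orbit_duality_def bij_betw_def)
    ultimately show "star C = D\<^sub>0" using f_inv_into_f by metis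
  qed
qed

end
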